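(* Let $f:\mathbb{R}\to\mathbb{R}$ be a twice-differentiable function, and suppose that for some $\alpha>0$, $f''$ is even symmetric over $[-\alpha,\alpha]$ (meaning $f''(x)=f''(-x)$ for all $x\in[-\alpha,\alpha]$), and $f''$ is decreasing over $[0,\alpha]$. Then the sharp quadratic (degree $2$) Taylor polynomial enclosure of $f$ over $[a,b]\subseteq[-\alpha,\alpha]$ at $x_0\in(a,b)$ is given by $$I^*_2(f,x_0,[a,b])=\left[\min\left\{\frac{R_1(a;f,x_0)}{(a-x_0)^2},\ \frac{R_1(b;f,x_0)}{(b-x_0)^2}\right\},\ \frac{R_1(c;f,x_0)}{(c-x_0)^2}\right],$$ where $c=\min\{b,\max\{-x_0,a\}\}$.
   Context: $R_1(x;f,x_0)=f(x)-f(x_0)-f'(x_0)(x-x_0)$ is the remainder of the degree $1$ Taylor polynomial of $f$ at $x_0$. For a closed real interval $I$ and a scalar $\beta$, $I\beta=\{z\beta:z\in I\}$. The sharp quadratic Taylor polynomial enclosure of $f$ at $x_0$ over the trust region $[a,b]$ is the interval-valued function $x\mapsto f(x_0)+f'(x_0)(x-x_0)+I\,(x-x_0)^2$ with $I=I^*_2(f,x_0,[a,b])$, where $$I^*_2(f,x_0,[a,b])=\left[\inf_{x\in[a,b]\setminus\{x_0\}}\frac{R_{1}(x;f,x_0)}{(x-x_0)^2},\ \sup_{x\in[a,b]\setminus\{x_0\}}\frac{R_{1}(x;f,x_0)}{(x-x_0)^2}\right].$$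
   Formalization: When x_0 = 0 lies in (a,b), c = x_0 and the upper end point R_1(c;f,x_0)/(c-x_0)^2 is the undefined 0/0; it is read there as the limit of R_1(x;f,x_0)/(x-x_0)^2 as x tends to x_0. *)

theory Defs
  imports "HOL-Analysis.Analysis"
begin

definition taylor_remainder1 :: "(real \<Rightarrow> real) \<Rightarrow> real \<Rightarrow> real \<Rightarrow> real" where
  "taylor_remainder1 f x0 x = f x - f x0 - deriv f x0 * (x - x0)"

text \<open>
  At \<open>x = x0\<close> the quotient \<open>R\<^sub>1(x; f, x0) / (x - x0)\<^sup>2\<close> has the form \<open>0 / 0\<close> and is read as its limit.
  With the library convention \<open>0 / 0 = 0\<close> a closed form that evaluates the quotient at \<open>x0\<close> would be wrong.
\<close>

definition remainder_quotient :: "(real \<Rightarrow> real) \<Rightarrow> real \<Rightarrow> real \<Rightarrow> real" where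
  "remainder_quotient f x0 x =
     (if x = x0 then Lim (at x0) (\<lambda>y. taylor_remainder1 f x0 y / (y - x0)\<^sup>2)
      else taylor_remainder1 f x0 x / (x - x0)\<^sup>2)"

text \<open>
  The infimum and supremum are taken in the extended reals, so that they are meaningful also when the
  quotient is unbounded; the interval itself is a set of real numbers.
\<close>

definition sharp_quadratic_interval :: "(real \<Rightarrow> real) \<Rightarrow> real \<Rightarrow> real \<Rightarrow> real \<Rightarrow> real set" where
  "sharp_quadratic_interval f x0 a b =
     {z. (INF x\<in>{a..b} - {x0}. ereal (taylor_remainder1 f x0 x / (x - x0)\<^sup>2)) \<le> ereal z \<and>
         ereal z \<le> (SUP x\<in>{a..b} - {x0}. ereal (taylor_remainder1 f x0 x / (x - x0)\<^sup>2))}"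

end

theory Submission imports Defs begin

text \<open>
  Write \<open>q\<close> for the quotient \<open>R\<^sub>1(x; f, x0) / (x - x0)\<^sup>2\<close>, continued to \<open>x0\<close> by its limit
  \<open>f''(x0) / 2\<close>.  The theorem holds because \<open>q\<close> is unimodal on \<open>[-\<alpha>, \<alpha>]\<close> with peak at \<open>-x0\<close>: it
  increases up to \<open>-x0\<close> and decreases afterwards.  On \<open>[a, b]\<close> its infimum is therefore attained
  at an end point and its supremum at \<open>c\<close>, the point of \<open>[a, b]\<close> closest to \<open>-x0\<close>.  Removing
  \<open>x0\<close> from \<open>[a, b]\<close> changes neither bound: \<open>x0\<close> is an interior point, so the end points stay, and
  the value at \<open>x0\<close> is a limit of the remaining values, which matters if \<open>c = x0 = 0\<close>.

  Unimodality comes from the identity \<open>q'(x) = T(x0, x) / (x - x0)\<^sup>3\<close>, where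
  \<open>T(u, v) = (f'(u) + f'(v)) (v - u) - 2 (f(v) - f(u))\<close> is twice the error of the trapezoidal rule
  for the integral of \<open>f'\<close> from \<open>u\<close> to \<open>v\<close>.  The key lemma is that \<open>T(u, v) \<le> 0\<close> as soon as
  \<open>\<bar>u\<bar> \<le> \<bar>v\<bar>\<close>.  As \<open>T\<close> is antisymmetric, this settles the sign of \<open>q'\<close> for every \<open>x\<close>, whatever
  the sign of \<open>x0\<close>.  The lemma is proved by moving the variable of larger modulus away from a zero
  of \<open>T\<close>: both \<open>T(u, u)\<close> and \<open>T(u, -u)\<close> vanish, the latter because \<open>f'\<close> is odd up to a constant,
  and by the mean value theorem \<open>T\<close> has the partial derivative \<open>(v - u) (f''(v) - f''(\<xi>))\<close> in \<open>v\<close>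
  with \<open>\<xi>\<close> between \<open>u\<close> and \<open>v\<close>.  When \<open>\<bar>u\<bar> \<le> \<bar>v\<bar>\<close>, also \<open>\<bar>\<xi>\<bar> \<le> \<bar>v\<bar>\<close>, and so
  \<open>f''(v) \<le> f''(\<xi>)\<close>.
\<close>

section \<open>The error of the trapezoidal rule\<close>

definition trapezoid_error :: "(real \<Rightarrow> real) \<Rightarrow> (real \<Rightarrow> real) \<Rightarrow> real \<Rightarrow> real \<Rightarrow> real" where
  "trapezoid_error f f' u v = (f' u + f' v) * (v - u) - 2 * (f v - f u)"

lemma trapezoid_error_antisym: "trapezoid_error f f' v u = - trapezoid_error f f' u v"
  by (simp add: trapezoid_error_def algebra_simps)

lemma trapezoid_error_refl [simp]: "trapezoid_error f f' u u = 0"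
  by (simp add: trapezoid_error_def)

lemma DERIV_trapezoid_error:
  assumes "(f has_real_derivative f' v) (at v)" and "(f' has_real_derivative D) (at v)"
  shows "(trapezoid_error f f' u has_real_derivative (v - u) * D - (f' v - f' u)) (at v)"
  unfolding trapezoid_error_def
  by (auto intro!: derivative_eq_intros assms simp: algebra_simps)

text \<open>
  As a function of \<open>u\<close>, \<open>T(-u, u)\<close> vanishes at \<open>0\<close> and has derivative
  \<open>2 u (f''(u) - f''(-u))\<close>, which is \<open>0\<close> because \<open>f''\<close> is even.
\<close>

lemma trapezoid_error_uminus:
  fixes f f' f'' :: "real \<Rightarrow> real"
  assumes f: "\<And>x. (f has_real_derivative f' x) (at x)"
    and f': "\<And>x. (f' has_real_derivative f'' x) (at x)"
    and even: "\<And>x. \<bar>x\<bar> \<le> \<alpha> \<Longrightarrow> f'' (-x) = f'' x"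
    and u: "\<bar>u\<bar> \<le> \<alpha>"
  shows "trapezoid_error f f' u (-u) = 0"
proof -
  let ?E = "\<lambda>s. trapezoid_error f f' (-s) s"
  have reflect: "((\<lambda>s. g (- s)) has_real_derivative - g' (- s)) (at s)"
    if "\<And>x. (g has_real_derivative g' x) (at x)" for g g' :: "real \<Rightarrow> real" and s
    using that[of "- s"] by (simp add: DERIV_mirror)
  have E: "(?E has_real_derivative 2 * s * (f'' s - f'' (-s))) (at s)" for s
    unfolding trapezoid_error_def
    by (auto intro!: derivative_eq_intros f f' reflect[OF f] reflect[OF f'] simp: algebra_simps)
  have "?E \<bar>u\<bar> = ?E 0"
  proof (cases "u = 0")
    case False
    show ?thesis
    proof (rule DERIV_isconst_end[where f = ?E])
      show "continuous_on {0..\<bar>u\<bar>} ?E"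
        by (intro continuous_at_imp_continuous_on ballI DERIV_isCont[OF E])
      show "(?E has_real_derivative 0) (at s)" if "0 < s" "s < \<bar>u\<bar>" for s
        using E[of s] even[of s] that u by simp
    qed (use False in simp)
  qed simp
  then show ?thesis
    using trapezoid_error_antisym[of f f' u "-u"] by (cases "u \<ge> 0") auto
qed

text \<open>
  The hypothesis \<open>decr\<close> says at once that \<open>f''\<close> is even and that it decreases in the modulus of its
  argument.  With \<open>u\<close> fixed, \<open>T(u, s)\<close> is \<open>0\<close> at \<open>s = \<bar>u\<bar>\<close> and at \<open>s = -\<bar>u\<bar>\<close>, and it can only
  decrease as \<open>s\<close> moves outwards from there to \<open>v\<close>, on whichever side \<open>v\<close> lies.
\<close>

lemma trapezoid_error_nonpos:
  fixes f f' f'' :: "real \<Rightarrow> real"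
  assumes f: "\<And>x. (f has_real_derivative f' x) (at x)"
    and f': "\<And>x. (f' has_real_derivative f'' x) (at x)"
    and decr: "\<And>s t. \<bar>s\<bar> \<le> \<bar>t\<bar> \<Longrightarrow> \<bar>t\<bar> \<le> \<alpha> \<Longrightarrow> f'' t \<le> f'' s"
    and uv: "\<bar>u\<bar> \<le> \<bar>v\<bar>" "\<bar>v\<bar> \<le> \<alpha>"
  shows "trapezoid_error f f' u v \<le> 0"
proof -
  let ?T = "trapezoid_error f f' u"
  have D: "(?T has_real_derivative (s - u) * f'' s - (f' s - f' u)) (at s)" for s
    by (rule DERIV_trapezoid_error[OF f f'])
  have cont: "continuous_on S ?T" for S
    by (intro continuous_at_imp_continuous_on ballI DERIV_isCont[OF D])
  have "f'' (-x) = f'' x" if "\<bar>x\<bar> \<le> \<alpha>" for x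
    using decr[of x "-x"] decr[of "-x" x] that by simp
  then have "?T (-u) = 0"
    using uv by (intro trapezoid_error_uminus[OF f f', where \<alpha> = \<alpha>]) simp_all
  then have zero: "?T \<bar>u\<bar> = 0" "?T (-\<bar>u\<bar>) = 0"
    by (simp_all add: abs_if)
  consider "\<bar>u\<bar> \<le> v" | "v \<le> -\<bar>u\<bar>" using uv by linarith
  then show ?thesis
  proof cases
    case 1
    have "?T v \<le> ?T \<bar>u\<bar>"
    proof (rule DERIV_nonpos_imp_decreasing_open[OF 1 _ cont])
      fix s assume s: "\<bar>u\<bar> < s" "s < v"
      then have "u < s" by linarith
      then obtain \<xi> where \<xi>: "u < \<xi>" "\<xi> < s" "f' s - f' u = (s - u) * f'' \<xi>"
        using MVT2[of u s f' f''] f' by blast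
      have "f'' s \<le> f'' \<xi>" using \<xi> s uv by (intro decr) auto
      then have "(s - u) * f'' s \<le> (s - u) * f'' \<xi>" using s by (intro mult_left_mono) auto
      then show "\<exists>y. (?T has_real_derivative y) (at s) \<and> y \<le> 0"
        using D[of s] \<xi> by (intro exI[of _ "(s - u) * f'' s - (f' s - f' u)"]) simp
    qed
    then show ?thesis using zero by simp
  next
    case 2
    have "?T v \<le> ?T (-\<bar>u\<bar>)"
    proof (rule DERIV_nonneg_imp_increasing_open[OF 2 _ cont])
      fix s assume s: "v < s" "s < -\<bar>u\<bar>"
      then have "s < u" by linarith
      then obtain \<xi> where \<xi>: "s < \<xi>" "\<xi> < u" "f' u - f' s = (u - s) * f'' \<xi>"
        using MVT2[of s u f' f''] f' by blast
      have "f'' s \<le> f'' \<xi>" using \<xi> s uv by (intro decr) auto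
      then have "(u - s) * f'' s \<le> (u - s) * f'' \<xi>" using s by (intro mult_left_mono) auto
      then show "\<exists>y. (?T has_real_derivative y) (at s) \<and> y \<ge> 0"
        using D[of s] \<xi>
        by (intro exI[of _ "(s - u) * f'' s - (f' s - f' u)"]) (simp add: algebra_simps)
    qed
    then show ?thesis using zero by simp
  qed
qed

section \<open>The remainder quotient as a continuous function\<close>

lemma taylor_remainder1_quotient_tendsto:
  assumes f: "\<And>x. (f has_real_derivative deriv f x) (at x)"
    and f': "(deriv f has_real_derivative D) (at x0)"
  shows "((\<lambda>x. taylor_remainder1 f x0 x / (x - x0)\<^sup>2) \<longlongrightarrow> D / 2) (at x0)"
proof (rule lhopital[where f' = "\<lambda>x. deriv f x - deriv f x0" and g' = "\<lambda>x. 2 * (x - x0)"])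
  have R: "(taylor_remainder1 f x0 has_real_derivative deriv f x - deriv f x0) (at x)" for x
    unfolding taylor_remainder1_def by (auto intro!: derivative_eq_intros f)
  then show "\<forall>\<^sub>F x in at x0. (taylor_remainder1 f x0 has_real_derivative deriv f x - deriv f x0) (at x)"
    by simp
  have "isCont (taylor_remainder1 f x0) x0" using R by (rule DERIV_isCont)
  then show "(taylor_remainder1 f x0 \<longlongrightarrow> 0) (at x0)"
    by (simp add: isCont_def taylor_remainder1_def)
  show "((\<lambda>x. (x - x0)\<^sup>2) \<longlongrightarrow> 0) (at x0)" by (auto intro!: tendsto_eq_intros)
  show "\<forall>\<^sub>F x in at x0. (x - x0)\<^sup>2 \<noteq> 0" "\<forall>\<^sub>F x in at x0. 2 * (x - x0) \<noteq> 0"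
    by (auto simp: eventually_at_filter)
  show "\<forall>\<^sub>F x in at x0. ((\<lambda>x. (x - x0)\<^sup>2) has_real_derivative 2 * (x - x0)) (at x)"
    by (intro always_eventually allI) (auto intro!: derivative_eq_intros)
  have "((\<lambda>x. (deriv f x - deriv f x0) / (x - x0) / 2) \<longlongrightarrow> D / 2) (at x0)"
    using f' by (intro tendsto_divide tendsto_const) (auto simp: has_field_derivative_iff)
  then show "((\<lambda>x. (deriv f x - deriv f x0) / (2 * (x - x0))) \<longlongrightarrow> D / 2) (at x0)"
    by (simp add: mult.commute)
qed

lemma DERIV_remainder_quotient:
  assumes f: "\<And>x. (f has_real_derivative deriv f x) (at x)" and x: "x \<noteq> x0"
  shows "(remainder_quotient f x0 has_real_derivative
    trapezoid_error f (deriv f) x0 x / (x - x0) ^ 3) (at x)"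
proof -
  have "((\<lambda>x. taylor_remainder1 f x0 x / (x - x0)\<^sup>2) has_real_derivative
      ((deriv f x - deriv f x0) * (x - x0)\<^sup>2 - taylor_remainder1 f x0 x * (2 * (x - x0)))
        / ((x - x0)\<^sup>2 * (x - x0)\<^sup>2)) (at x)"
    unfolding taylor_remainder1_def
    by (rule DERIV_divide) (use x in \<open>auto intro!: derivative_eq_intros f\<close>)
  also have "((deriv f x - deriv f x0) * (x - x0)\<^sup>2 - taylor_remainder1 f x0 x * (2 * (x - x0)))
      / ((x - x0)\<^sup>2 * (x - x0)\<^sup>2) = trapezoid_error f (deriv f) x0 x / (x - x0) ^ 3"
  proof -
    have "(deriv f x - deriv f x0) * (x - x0)\<^sup>2 - taylor_remainder1 f x0 x * (2 * (x - x0))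
      = trapezoid_error f (deriv f) x0 x * (x - x0)"
      by (simp add: taylor_remainder1_def trapezoid_error_def algebra_simps power2_eq_square)
    moreover have "(x - x0)\<^sup>2 * (x - x0)\<^sup>2 = (x - x0) ^ 3 * (x - x0)"
      by (simp add: power2_eq_square power3_eq_cube)
    ultimately show ?thesis using x by simp
  qed
  finally show ?thesis
    by (rule has_field_derivative_transform_within_open[where S = "- {x0}"])
      (use x in \<open>auto simp: remainder_quotient_def\<close>)
qed

lemma isCont_remainder_quotient:
  assumes f: "\<And>x. (f has_real_derivative deriv f x) (at x)"
    and f': "(deriv f has_real_derivative D) (at x0)"
  shows "isCont (remainder_quotient f x0) x"
proof (cases "x = x0")
  case True
  have lim: "((\<lambda>x. taylor_remainder1 f x0 x / (x - x0)\<^sup>2) \<longlongrightarrow> D / 2) (at x0)"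
    using assms by (rule taylor_remainder1_quotient_tendsto)
  then have "remainder_quotient f x0 x0 = D / 2"
    by (simp add: remainder_quotient_def tendsto_Lim)
  moreover have "(remainder_quotient f x0 \<longlongrightarrow> D / 2) (at x0)"
    using lim by (rule Lim_transform_eventually)
      (simp add: eventually_at_filter remainder_quotient_def)
  ultimately show ?thesis using True by (simp only: isCont_def)
next
  case False
  show ?thesis using DERIV_remainder_quotient[OF f False] by (rule DERIV_isCont)
qed

section \<open>Unimodality of the remainder quotient\<close>

lemma DERIV_nonneg_imp_increasing_except_point:
  fixes g :: "real \<Rightarrow> real"
  assumes "u \<le> v"
    and deriv: "\<And>x. u < x \<Longrightarrow> x < v \<Longrightarrow> x \<noteq> p \<Longrightarrow> \<exists>y. (g has_real_derivative y) (at x) \<and> y \<ge> 0"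
    and cont: "continuous_on {u..v} g"
  shows "g u \<le> g v"
proof (cases "u < p \<and> p < v")
  case True
  have "g u \<le> g p"
    by (rule DERIV_nonneg_imp_increasing_open)
      (use True deriv cont in \<open>auto intro: continuous_on_subset\<close>)
  also have "g p \<le> g v"
    by (rule DERIV_nonneg_imp_increasing_open)
      (use True deriv cont in \<open>auto intro: continuous_on_subset\<close>)
  finally show ?thesis .
next
  case False
  show ?thesis
    by (rule DERIV_nonneg_imp_increasing_open) (use False assms in auto)
qed

lemma remainder_quotient_unimodal:
  assumes f: "\<And>x. (f has_real_derivative deriv f x) (at x)"
    and f': "\<And>x. (deriv f has_real_derivative deriv (deriv f) x) (at x)"
    and decr: "\<And>s t. \<bar>s\<bar> \<le> \<bar>t\<bar> \<Longrightarrow> \<bar>t\<bar> \<le> \<alpha> \<Longrightarrow> deriv (deriv f) t \<le> deriv (deriv f) s"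
    and x0: "\<bar>x0\<bar> \<le> \<alpha>"
  shows "mono_on {-\<alpha>..-x0} (remainder_quotient f x0)"
    and "antimono_on {-x0..\<alpha>} (remainder_quotient f x0)"
proof -
  let ?q = "remainder_quotient f x0" and ?T = "trapezoid_error f (deriv f)"
  note q' = DERIV_remainder_quotient[OF f]
  have cont: "continuous_on S ?q" for S
    by (intro continuous_at_imp_continuous_on ballI isCont_remainder_quotient[OF f f'])
  have T_nonpos: "?T u v \<le> 0" if "\<bar>u\<bar> \<le> \<bar>v\<bar>" "\<bar>v\<bar> \<le> \<alpha>" for u v
    by (rule trapezoid_error_nonpos[OF f f', where \<alpha> = \<alpha>]) (fact decr that)+
  have T_nonneg: "?T u v \<ge> 0" if "\<bar>v\<bar> \<le> \<bar>u\<bar>" "\<bar>u\<bar> \<le> \<alpha>" for u v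
    using T_nonpos[OF that] trapezoid_error_antisym[of f "deriv f" v u] by simp
  \<comment> \<open>The sign of \<open>T(x0, x)\<close> is opposite to that of \<open>\<bar>x\<bar> - \<bar>x0\<bar>\<close>, that is, of
     \<open>(x - x0) (x + x0)\<close>; dividing by the cube removes the sign of \<open>x - x0\<close> and leaves that of
     \<open>-(x + x0)\<close>.\<close>
  have left: "?T x0 x / (x - x0) ^ 3 \<ge> 0" if "-\<alpha> \<le> x" "x < -x0" "x \<noteq> x0" for x
  proof (cases "x < x0")
    case True
    have "?T x0 x \<le> 0" by (rule T_nonpos) (use True that in linarith)+
    then show ?thesis using True by (intro divide_nonpos_neg) simp_all
  next
    case False
    have "?T x0 x \<ge> 0" by (rule T_nonneg) (use False that x0 in linarith)+
    then show ?thesis using False that by (intro divide_nonneg_pos) simp_all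
  qed
  have right: "?T x0 x / (x - x0) ^ 3 \<le> 0" if "-x0 < x" "x \<le> \<alpha>" "x \<noteq> x0" for x
  proof (cases "x < x0")
    case True
    have "?T x0 x \<ge> 0" by (rule T_nonneg) (use True that x0 in linarith)+
    then show ?thesis using True by (intro divide_nonneg_neg) simp_all
  next
    case False
    have "?T x0 x \<le> 0" by (rule T_nonpos) (use False that in linarith)+
    then show ?thesis using False that by (intro divide_nonpos_pos) simp_all
  qed
  show "mono_on {-\<alpha>..-x0} ?q"
  proof (rule mono_onI)
    fix u v assume uv: "u \<in> {-\<alpha>..-x0}" "v \<in> {-\<alpha>..-x0}" "u \<le> v"
    show "?q u \<le> ?q v"
    proof (rule DERIV_nonneg_imp_increasing_except_point[where g = ?q and p = x0])
      fix x assume "u < x" "x < v" "x \<noteq> x0"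
      then show "\<exists>y. (?q has_real_derivative y) (at x) \<and> y \<ge> 0"
        using uv left[of x] q'[OF \<open>x \<noteq> x0\<close>] by auto
    qed (use uv cont in auto)
  qed
  show "antimono_on {-x0..\<alpha>} ?q"
  proof (rule monotone_onI)
    fix u v assume uv: "u \<in> {-x0..\<alpha>}" "v \<in> {-x0..\<alpha>}" "u \<le> v"
    have "- ?q u \<le> - ?q v"
    proof (rule DERIV_nonneg_imp_increasing_except_point[where g = "\<lambda>x. - ?q x" and p = x0])
      fix x assume "u < x" "x < v" "x \<noteq> x0"
      then show "\<exists>y. ((\<lambda>x. - ?q x) has_real_derivative y) (at x) \<and> y \<ge> 0"
        using uv right[of x] DERIV_minus[OF q'[OF \<open>x \<noteq> x0\<close>]] by fastforce
    qed (use uv in \<open>auto intro: continuous_on_minus cont\<close>)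
    then show "?q u \<ge> ?q v" by simp
  qed
qed

section \<open>Extrema over a punctured interval\<close>

text \<open>
  A maximum at the removed point itself is still the supremum, by continuity.
\<close>

lemma SUP_punctured_interval_eq_max:
  fixes g :: "real \<Rightarrow> real"
  assumes "a < b" and c: "c \<in> {a..b}" and cont: "isCont g c"
    and max: "\<And>x. x \<in> {a..b} \<Longrightarrow> g x \<le> g c"
  shows "(SUP x\<in>{a..b} - {p}. ereal (g x)) = ereal (g c)"
proof (rule antisym)
  show "(SUP x\<in>{a..b} - {p}. ereal (g x)) \<le> ereal (g c)"
    using max by (intro SUP_least) auto
  let ?F = "at c within {a..b} - {p}"
  have "c islimpt {a..b}" using \<open>a < b\<close> c by simp
  then have "c islimpt insert p ({a..b} - {p})" by (rule islimpt_subset) auto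
  then have "?F \<noteq> bot" unfolding islimpt_insert by (simp only: trivial_limit_within not_not)
  moreover have "((\<lambda>x. ereal (g x)) \<longlongrightarrow> ereal (g c)) ?F"
    using cont by (intro tendsto_ereal) (simp add: continuous_at_imp_continuous_at_within
        flip: continuous_within)
  moreover have "\<forall>\<^sub>F x in ?F. ereal (g x) \<le> (SUP x\<in>{a..b} - {p}. ereal (g x))"
    unfolding eventually_at_filter by (intro always_eventually allI impI SUP_upper)
  ultimately show "ereal (g c) \<le> (SUP x\<in>{a..b} - {p}. ereal (g x))"
    by (intro tendsto_upperbound)
qed

section \<open>The sharp quadratic enclosure\<close>

theorem theorem2:
  fixes f :: "real \<Rightarrow> real" and \<alpha> a b x0 c :: real
  assumes "f differentiable_on UNIV"
    and "deriv f differentiable_on UNIV"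
    and "\<alpha> > 0"
    and "\<forall>x\<in>{-\<alpha>..\<alpha>}. deriv (deriv f) x = deriv (deriv f) (-x)"
    and "antimono_on {0..\<alpha>} (deriv (deriv f))"
    and "{a..b} \<subseteq> {-\<alpha>..\<alpha>}"
    and "x0 \<in> {a<..<b}"
    and "c = min b (max (-x0) a)"
  shows "sharp_quadratic_interval f x0 a b =
    {min (taylor_remainder1 f x0 a / (a - x0)\<^sup>2) (taylor_remainder1 f x0 b / (b - x0)\<^sup>2)
     .. remainder_quotient f x0 c}"
proof -
  let ?q = "remainder_quotient f x0" and ?f'' = "deriv (deriv f)"
  have f: "(f has_real_derivative deriv f x) (at x)" for x
    using assms(1) by (simp add: differentiable_on_def DERIV_deriv_iff_real_differentiable)
  have f': "(deriv f has_real_derivative ?f'' x) (at x)" for x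
    using assms(2) by (simp add: differentiable_on_def DERIV_deriv_iff_real_differentiable)
  have abs: "?f'' x = ?f'' \<bar>x\<bar>" if "\<bar>x\<bar> \<le> \<alpha>" for x
    using bspec[OF assms(4), of x] that by (simp add: abs_if abs_le_iff split: if_splits)
  have decr: "?f'' t \<le> ?f'' s" if "\<bar>s\<bar> \<le> \<bar>t\<bar>" "\<bar>t\<bar> \<le> \<alpha>" for s t
    using monotone_onD[OF assms(5), of "\<bar>s\<bar>" "\<bar>t\<bar>"] abs[of s] abs[of t] that by simp
  have ab: "a < x0" "x0 < b" "-\<alpha> \<le> a" "b \<le> \<alpha>"
    using assms(6,7) by auto
  then have x0: "\<bar>x0\<bar> \<le> \<alpha>" by linarith
  have "mono_on {-\<alpha>..-x0} ?q" "antimono_on {-x0..\<alpha>} ?q"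
    by (rule remainder_quotient_unimodal[OF f f']; fact decr x0)+
  note mono = monotone_onD[OF this(1)] and antimono = monotone_onD[OF this(2)]
  have c: "c \<in> {a..b}" using ab assms(8) by auto
  have le: "?q x \<le> ?q c" if x: "x \<in> {a..b}" for x
  proof (cases "x \<le> -x0")
    case True
    then have "x \<le> c" "c \<le> -x0 \<or> c = x" using x assms(8) by auto
    then show ?thesis using True x c ab by (auto intro: mono)
  next
    case False
    then have "c \<le> x" "-x0 \<le> c \<or> c = x" using x assms(8) by auto
    then show ?thesis using False x c ab by (auto intro: antimono)
  qed
  have ge: "min (?q a) (?q b) \<le> ?q x" if x: "x \<in> {a..b}" for x
  proof (cases "x \<le> -x0")
    case True
    then have "?q a \<le> ?q x" using x ab by (intro mono) auto
    then show ?thesis by simp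
  next
    case False
    then have "?q b \<le> ?q x" using x ab by (intro antimono) auto
    then show ?thesis by simp
  qed
  have "(INF x\<in>{a..b} - {x0}. ereal (?q x)) = ereal (min (?q a) (?q b))"
  proof (rule antisym)
    have "{a, b} \<subseteq> {a..b} - {x0}" using ab by auto
    then have "(INF x\<in>{a..b} - {x0}. ereal (?q x)) \<le> (INF x\<in>{a, b}. ereal (?q x))"
      by (rule INF_superset_mono) simp
    then show "(INF x\<in>{a..b} - {x0}. ereal (?q x)) \<le> ereal (min (?q a) (?q b))"
      by (simp add: inf_min)
    show "ereal (min (?q a) (?q b)) \<le> (INF x\<in>{a..b} - {x0}. ereal (?q x))"
      by (rule INF_greatest) (metis DiffD1 ereal_less_eq(3) ge)
  qed
  moreover have "(SUP x\<in>{a..b} - {x0}. ereal (?q x)) = ereal (?q c)"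
  proof (rule SUP_punctured_interval_eq_max[where g = ?q])
    show "isCont ?q c" by (rule isCont_remainder_quotient[OF f f'])
  qed (use ab c le in auto)
  moreover have quotient: "taylor_remainder1 f x0 x / (x - x0)\<^sup>2 = ?q x" if "x \<noteq> x0" for x
    using that by (simp add: remainder_quotient_def)
  then have "(\<lambda>x. ereal (taylor_remainder1 f x0 x / (x - x0)\<^sup>2)) ` ({a..b} - {x0})
      = (\<lambda>x. ereal (?q x)) ` ({a..b} - {x0})"
    by (intro image_cong) auto
  moreover have "taylor_remainder1 f x0 a / (a - x0)\<^sup>2 = ?q a"
    "taylor_remainder1 f x0 b / (b - x0)\<^sup>2 = ?q b"
    using ab by (auto intro!: quotient)
  ultimately show ?thesis
    unfolding sharp_quadratic_interval_def atLeastAtMost_def atLeast_def atMost_def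
    by (simp only: ereal_less_eq Collect_conj_eq)
qed

end
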